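(* Let $D\subset\mathbb R^2$ be an open set with coordinates $(x,y)$ and let $\gamma=(\gamma_1,\gamma_2):D\to D$ be a diffeomorphism. Let $U:D\to\widetilde\Lambda SU(2)$, $(x,y)\mapsto U(x,y;\lambda)$, be smooth, let $K:D\to SU(2)$ be a smooth function $K(x,y)$ (independent of $\lambda$), and let $\chi(\lambda)\in SU(2)$ be a function of $\lambda\in\mathbb R^*$ only. Suppose that for a smooth real function $\phi$ on $D$ and smooth positive functions $a=a(x)$, $b=b(y)$, $$\frac{\partial U}{\partial x}=\frac{i}{2}\,U\begin{bmatrix}-\phi_x & a(x)\lambda\\ a(x)\lambda & \phi_x\end{bmatrix},\qquad \frac{\partial U}{\partial y}=-\frac{i\,b(y)}{2\lambda}\,U\begin{bmatrix}0& e^{i\phi}\\ e^{-i\phi}&0\end{bmatrix}$$ on $D$ for every $\lambda$, and that $$U\circ\gamma=\chi\,U\,K$$ on $D$ for every $\lambda$, where $(U\circ\gamma)(x,y;\lambda)=U(\gamma(x,y);\lambda)$. Then $\gamma$ takes $x$-coordinate curves to $x$-coordinate curves and $y$-coordinate curves to $y$-coordinate curves; that is, $\partial\gamma_2/\partial x=0$ and $\partial\gamma_1/\partial y=0$ on $D$.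
   Context: $\mathbb R^*=\mathbb R\setminus\{0\}$, $\mathbb C^*=\mathbb C\setminus\{0\}$, $\sigma_3=\operatorname{diag}(1,-1)$. $\widetilde\Lambda SU(2)$ is the group of maps $g:\mathbb R^*\to SU(2)$ satisfying the twisting condition $g(-\lambda)=\sigma_3\,g(\lambda)\,\sigma_3^{-1}$ which extend to analytic maps $\mathbb C^*\to SL(2,\mathbb C)$. An $x$-coordinate curve is a curve in $D$ along which $y$ is constant, and a $y$-coordinate curve is one along which $x$ is constant. *)

theory Defs
  imports "HOL-Analysis.Analysis"
begin

subsection \<open>Smooth maps on open subsets of Euclidean spaces\<close>

text \<open>
  \<open>Ck_on k S f\<close> is used only for open \<open>S\<close>, where the Frechet derivative at a point of \<open>S\<close> depends
  only on \<open>f\<close> restricted to \<open>S\<close>. As the domain is finite-dimensional, continuity of the derivative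
  in operator norm is the same as continuity of all directional derivatives.
\<close>
primrec Ck_on :: "nat \<Rightarrow> 'a::euclidean_space set \<Rightarrow> ('a \<Rightarrow> 'b::real_normed_vector) \<Rightarrow> bool" where
  "Ck_on 0 S f \<longleftrightarrow> continuous_on S f"
| "Ck_on (Suc k) S f \<longleftrightarrow>
     (\<forall>p\<in>S. f differentiable (at p)) \<and> (\<forall>v. Ck_on k S (\<lambda>p. frechet_derivative f (at p) v))"

definition smooth_on :: "'a::euclidean_space set \<Rightarrow> ('a \<Rightarrow> 'b::real_normed_vector) \<Rightarrow> bool" where
  "smooth_on S f \<longleftrightarrow> (\<forall>k. Ck_on k S f)"

definition diffeomorphism_on ::
    "'a::euclidean_space set \<Rightarrow> 'b::euclidean_space set \<Rightarrow> ('a \<Rightarrow> 'b) \<Rightarrow> bool" where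
  "diffeomorphism_on S T f \<longleftrightarrow> bij_betw f S T \<and> smooth_on S f \<and> smooth_on T (inv_into S f)"

definition partial_x :: "(real \<times> real \<Rightarrow> 'b::real_normed_vector) \<Rightarrow> real \<times> real \<Rightarrow> 'b" where
  "partial_x f p = vector_derivative (\<lambda>t. f (t, snd p)) (at (fst p))"

definition partial_y :: "(real \<times> real \<Rightarrow> 'b::real_normed_vector) \<Rightarrow> real \<times> real \<Rightarrow> 'b" where
  "partial_y f p = vector_derivative (\<lambda>t. f (fst p, t)) (at (snd p))"

subsection \<open>Coordinate curves\<close>

definition curve_in :: "(real \<times> real) set \<Rightarrow> real set \<Rightarrow> (real \<Rightarrow> real \<times> real) \<Rightarrow> bool" where
  "curve_in D I c \<longleftrightarrow> is_interval I \<and> continuous_on I c \<and> c ` I \<subseteq> D"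

definition x_coordinate_curve :: "(real \<times> real) set \<Rightarrow> real set \<Rightarrow> (real \<Rightarrow> real \<times> real) \<Rightarrow> bool" where
  "x_coordinate_curve D I c \<longleftrightarrow> curve_in D I c \<and> (snd \<circ> c) constant_on I"

definition y_coordinate_curve :: "(real \<times> real) set \<Rightarrow> real set \<Rightarrow> (real \<Rightarrow> real \<times> real) \<Rightarrow> bool" where
  "y_coordinate_curve D I c \<longleftrightarrow> curve_in D I c \<and> (fst \<circ> c) constant_on I"

subsection \<open>The twisted loop group\<close>

text \<open>The 2 by 2 matrix with rows \<open>(a, b)\<close> and \<open>(c, d)\<close>.\<close>
definition mat2 :: "'a::zero \<Rightarrow> 'a \<Rightarrow> 'a \<Rightarrow> 'a \<Rightarrow> 'a^2^2" where
  "mat2 a b c d = vector [vector [a, b], vector [c, d]]"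

text \<open>Multiplication by a complex scalar; the library's \<open>*\<^sub>R\<close> only covers real scalars.\<close>
definition cscale :: "complex \<Rightarrow> complex^'n^'m \<Rightarrow> complex^'n^'m" (infixr "*\<^sub>C" 75) where
  "c *\<^sub>C A = map_matrix ((*) c) A"

definition conj_transpose :: "complex^'n^'m \<Rightarrow> complex^'m^'n" where
  "conj_transpose A = map_matrix cnj (transpose A)"

definition SU2 :: "(complex^2^2) set" where
  "SU2 = {A. conj_transpose A ** A = mat 1 \<and> A ** conj_transpose A = mat 1 \<and> det A = 1}"

definition SL2C :: "(complex^2^2) set" where
  "SL2C = {A. det A = 1}"

definition sigma3 :: "complex^2^2" where
  "sigma3 = mat2 1 0 0 (-1)"

text \<open>
  Loops are defined on the nonzero reals; being total functions here, their value at \<open>0\<close> is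
  unconstrained and irrelevant.
\<close>
definition twisted_loop_SU2 :: "(real \<Rightarrow> complex^2^2) set" where
  "twisted_loop_SU2 = {g.
     (\<forall>l. l \<noteq> 0 \<longrightarrow> g l \<in> SU2) \<and>
     (\<forall>l. l \<noteq> 0 \<longrightarrow> g (- l) = sigma3 ** g l ** matrix_inv sigma3) \<and>
     (\<exists>G. (\<forall>i j. (\<lambda>z. G z $ i $ j) analytic_on (- {0})) \<and>
          (\<forall>z. z \<noteq> 0 \<longrightarrow> G z \<in> SL2C) \<and>
          (\<forall>l. l \<noteq> 0 \<longrightarrow> G (complex_of_real l) = g l))}"

end

theory Submission
  imports Defs
begin

text \<open>
  Differentiating \<open>U \<circ> \<gamma> = \<chi> U K\<close> in a direction \<open>w\<close> and cancelling \<open>\<chi> U\<close> yields an identity of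
  Laurent polynomials in \<open>\<lambda>\<close> with coefficients that are matrices independent of \<open>\<lambda>\<close>. For \<open>w = (1, 0)\<close>
  its right-hand side has no \<open>1/\<lambda>\<close> term, while the one on the left is a nonzero matrix times
  \<open>\<partial>\<gamma>\<^sub>2/\<partial>x\<close>; for \<open>w = (0, 1)\<close> the \<open>\<lambda>\<close> term plays the same role for \<open>\<partial>\<gamma>\<^sub>1/\<partial>y\<close>.
\<close>

section \<open>Laurent polynomials in a nonzero real variable\<close>

lemma Laurent_coeffs_zero:
  fixes A B C :: "'a::real_vector"
  assumes "\<forall>l. l \<noteq> 0 \<longrightarrow> A + l *\<^sub>R B + (1 / l) *\<^sub>R C = 0"
  shows "A = 0" and "B = 0" and "C = 0"
proof -
  \<comment> \<open>Three values of \<open>l\<close> suffice. The values \<open>1\<close> and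
    \<open>-1\<close> separate \<open>A\<close> from the odd part \<open>B + C\<close>; the value
    \<open>2\<close> then separates \<open>B\<close> from \<open>C = - B\<close>, because
    \<open>2 - 1/2\<close> is nonzero.\<close>
  have p: "A + B + C = 0" and m: "A - B - C = 0"
    using assms[rule_format, of 1] assms[rule_format, of "-1"] by simp_all
  have "2 *\<^sub>R A = (A + B + C) + (A - B - C)"
    by (simp add: scaleR_2)
  then show A: "A = 0"
    using p m by simp
  then have C: "C = - B"
    using p by (simp add: add_eq_0_iff)
  have "(3 / 2) *\<^sub>R B = A + 2 *\<^sub>R B + (1 / 2) *\<^sub>R C"
    using A C by (simp flip: scaleR_diff_left)
  then show "B = 0"
    using assms[rule_format, of 2] by simp
  then show "C = 0"
    using C by simp
qed

section \<open>Frechet derivatives and partial derivatives\<close>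

lemma smooth_on_imp_differentiable: "smooth_on S f \<Longrightarrow> p \<in> S \<Longrightarrow> f differentiable (at p)"
  unfolding smooth_on_def using Ck_on.simps(2)[of 0 S f] by blast

lemma smooth_on_imp_has_derivative:
  "smooth_on S f \<Longrightarrow> p \<in> S \<Longrightarrow> (f has_derivative frechet_derivative f (at p)) (at p)"
  using smooth_on_imp_differentiable frechet_derivative_works by blast

text \<open>The set \<open>S\<close> is left free for two uses: the whole line yields
  \<open>partial_x\<close>, and the projection of a coordinate curve, which need not be open, yields
  the derivative from which constancy along the curve is deduced.\<close>

lemma has_derivative_imp_has_vector_derivative_x:
  assumes "(f has_derivative f') (at p)"
  shows "((\<lambda>t. f (t, snd p)) has_vector_derivative f' (1, 0)) (at (fst p) within S)"
proof -
  have "((\<lambda>t. (t, snd p)) has_vector_derivative (1, 0)) (at (fst p) within S)"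
    by (auto intro!: derivative_eq_intros)
  then show ?thesis
    using vector_derivative_diff_chain_within[of "\<lambda>t. (t, snd p)" "(1, 0)" "fst p" S f f']
      has_derivative_at_withinI[OF assms]
    by (simp add: o_def)
qed

lemma has_derivative_imp_has_vector_derivative_y:
  assumes "(f has_derivative f') (at p)"
  shows "((\<lambda>t. f (fst p, t)) has_vector_derivative f' (0, 1)) (at (snd p) within S)"
proof -
  have "((\<lambda>t. (fst p, t)) has_vector_derivative (0, 1)) (at (snd p) within S)"
    by (auto intro!: derivative_eq_intros)
  then show ?thesis
    using vector_derivative_diff_chain_within[of "\<lambda>t. (fst p, t)" "(0, 1)" "snd p" S f f']
      has_derivative_at_withinI[OF assms]
    by (simp add: o_def)
qed

lemma partial_x_eq: "(f has_derivative f') (at p) \<Longrightarrow> partial_x f p = f' (1, 0)"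
  unfolding partial_x_def
  by (intro vector_derivative_at has_derivative_imp_has_vector_derivative_x)

lemma partial_y_eq: "(f has_derivative f') (at p) \<Longrightarrow> partial_y f p = f' (0, 1)"
  unfolding partial_y_def
  by (intro vector_derivative_at has_derivative_imp_has_vector_derivative_y)

text \<open>With this the two differential equations determine the derivative of \<open>U\<close> in
  every direction, in particular in the image direction at \<open>\<gamma> p\<close>, which a priori
  has both components.\<close>

lemma has_derivative_eq_partials:
  assumes "(f has_derivative f') (at p)"
  shows "f' w = fst w *\<^sub>R partial_x f p + snd w *\<^sub>R partial_y f p"
proof -
  interpret linear f'
    using assms by (rule has_derivative_linear)
  have "f' w = f' (fst w *\<^sub>R (1, 0) + snd w *\<^sub>R (0, 1))"
    by simp
  also have "\<dots> = fst w *\<^sub>R f' (1, 0) + snd w *\<^sub>R f' (0, 1)"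
    by (simp only: add scale)
  finally show ?thesis
    using assms by (simp add: partial_x_eq partial_y_eq)
qed

section \<open>Complex matrices and the derivative of a matrix product\<close>

lemma bounded_bilinear_matrix_mult:
  "bounded_bilinear ((**) :: complex^'n^'m \<Rightarrow> complex^'k^'n \<Rightarrow> complex^'k^'m)"
  unfolding bilinear_conv_bounded_bilinear[symmetric] bilinear_def
  by (intro conjI allI linearI)
    (simp_all add: matrix_matrix_mult_def vec_eq_iff sum.distrib scaleR_sum_right distrib_left
      distrib_right)

text \<open>This makes the product rule available for matrix-valued functions, together with the
  distributive and scalar laws used to sort terms by powers of the loop parameter.\<close>

interpretation matrix_mult: bounded_bilinear
  "(**) :: complex^'n^'m \<Rightarrow> complex^'k^'n \<Rightarrow> complex^'k^'m"
  by (rule bounded_bilinear_matrix_mult)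

lemma mat2_eq_iff: "mat2 a b c d = mat2 a' b' c' d' \<longleftrightarrow> a = a' \<and> b = b' \<and> c = c' \<and> d = d'"
  by (auto simp: mat2_def vec_eq_iff forall_2 vector_2)

lemma cscale_mult_right: "c *\<^sub>C (A ** B) = A ** (c *\<^sub>C B)"
  by (simp add: cscale_def map_matrix_def matrix_matrix_mult_def vec_eq_iff sum_distrib_left
      mult.left_commute)

lemma cscale_mat2: "c *\<^sub>C mat2 p q r s = mat2 (c * p) (c * q) (c * r) (c * s)"
  by (simp add: cscale_def map_matrix_def mat2_def vec_eq_iff forall_2 vector_2)

lemma mat2_add: "mat2 p q r s + mat2 p' q' r' s' = mat2 (p + p') (q + q') (r + r') (s + s')"
  for p :: complex
  by (simp add: mat2_def vec_eq_iff forall_2 vector_2)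

lemma scaleR_mat2: "t *\<^sub>R mat2 p q r s = mat2 (t *\<^sub>R p) (t *\<^sub>R q) (t *\<^sub>R r) (t *\<^sub>R s)"
  for p :: complex
  by (simp add: mat2_def vec_eq_iff forall_2 vector_2)

lemma mat2_zero: "mat2 0 0 0 0 = (0 :: complex^2^2)"
  by (simp add: mat2_def vec_eq_iff forall_2 vector_2)

lemma SU2_invertible: "A \<in> SU2 \<Longrightarrow> invertible A"
  unfolding SU2_def invertible_def by blast

lemma invertible_mult_left_cancel:
  assumes "invertible A" and "A ** X = A ** Y"
  shows "X = Y"
proof -
  obtain B where "B ** A = mat 1"
    using assms(1) by (auto simp: invertible_def)
  moreover have "B ** A ** X = B ** A ** Y"
    by (simp add: assms(2) flip: matrix_mul_assoc)
  ultimately show ?thesis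
    by simp
qed

text \<open>The chain rule applies to \<open>F (g q)\<close> and the product rule to
  \<open>X ** F q ** K q\<close>, with \<open>X\<close> constant. As \<open>D\<close> is open,
  agreement of the two functions on \<open>D\<close> is agreement near \<open>p\<close>, so
  uniqueness of the derivative equates the results.\<close>

lemma derivative_equivariance:
  fixes F K :: "'a::euclidean_space \<Rightarrow> complex^2^2"
  assumes "open D" and "p \<in> D"
    and g: "(g has_derivative g') (at p)"
    and F: "(F has_derivative F') (at p)"
    and Fg: "(F has_derivative G') (at (g p))"
    and K: "(K has_derivative K') (at p)"
    and eq: "\<forall>q\<in>D. F (g q) = X ** F q ** K q"
  shows "G' (g' w) = X ** F p ** K' w + X ** F' w ** K p"
proof -
  have "((\<lambda>q. F (g q)) has_derivative (\<lambda>w. G' (g' w))) (at p)"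
    using diff_chain_at[OF g Fg] by (simp add: o_def)
  moreover have "((\<lambda>q. X ** F q ** K q) has_derivative
      (\<lambda>w. X ** F p ** K' w + X ** F' w ** K p)) (at p)"
    by (intro matrix_mult.FDERIV K bounded_linear.has_derivative[OF _ F]
        matrix_mult.bounded_linear_right)
  then have "((\<lambda>q. F (g q)) has_derivative
      (\<lambda>w. X ** F p ** K' w + X ** F' w ** K p)) (at p)"
    by (rule has_derivative_transform_within_open[OF _ assms(1,2)]) (simp add: eq)
  ultimately show ?thesis
    by (rule fun_cong[OF has_derivative_unique])
qed

section \<open>Functions constant along coordinate curves\<close>

lemma constant_on_partial_x_zero:
  fixes f :: "real \<times> real \<Rightarrow> real"
  assumes curve: "x_coordinate_curve D I c"
    and diff: "\<And>p. p \<in> D \<Longrightarrow> f differentiable (at p)"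
    and zero: "\<And>p. p \<in> D \<Longrightarrow> partial_x f p = 0"
  shows "(f \<circ> c) constant_on I"
proof -
  have int: "is_interval I" and cont: "continuous_on I c" and sub: "c ` I \<subseteq> D"
    and "(snd \<circ> c) constant_on I"
    using curve by (auto simp: x_coordinate_curve_def curve_in_def)
  then obtain y where y: "\<And>t. t \<in> I \<Longrightarrow> snd (c t) = y"
    by (auto simp: constant_on_def)
  \<comment> \<open>The curve is merely continuous and may run back and forth, so
    \<open>f \<circ> c\<close> is not differentiated. Its projection \<open>J\<close> to the first
    axis is an interval, possibly a single point, and the segment over \<open>J\<close> at height
    \<open>y\<close> lies in \<open>D\<close>; there \<open>f\<close> is a function of one variable
    with zero derivative.\<close>
  define J where "J = fst ` c ` I"
  have "connected J"
    unfolding J_def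
    using int cont is_interval_connected
    by (intro connected_continuous_image continuous_intros) auto
  then have "convex J"
    by (simp add: is_interval_connected_1 is_interval_convex)
  have inD: "(x, y) \<in> D" if x: "x \<in> J" for x
  proof -
    obtain t where "t \<in> I" and "x = fst (c t)"
      using x unfolding J_def by blast
    then have "(x, y) = c t"
      using y by (simp add: prod_eq_iff)
    then show ?thesis
      using sub \<open>t \<in> I\<close> by auto
  qed
  have "((\<lambda>t. f (t, y)) has_derivative (\<lambda>h. 0)) (at x within J)" if x: "x \<in> J" for x
  proof -
    obtain f' where f': "(f has_derivative f') (at (x, y))"
      using diff[OF inD[OF x]] by (auto simp: differentiable_def)
    have "f' (1, 0) = 0"
      using zero[OF inD[OF x]] partial_x_eq[OF f'] by simp
    then show ?thesis
      using has_derivative_imp_has_vector_derivative_x[OF f', of J]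
      by (simp add: has_vector_derivative_def)
  qed
  then obtain k where k: "\<And>x. x \<in> J \<Longrightarrow> f (x, y) = k"
    using has_derivative_zero_constant[OF \<open>convex J\<close>] by metis
  have "(f \<circ> c) t = k" if "t \<in> I" for t
  proof -
    have "fst (c t) \<in> J" and "c t = (fst (c t), y)"
      using that y by (auto simp: J_def prod_eq_iff)
    then show ?thesis
      using k by (metis comp_apply)
  qed
  then show ?thesis
    by (auto simp: constant_on_def)
qed

text \<open>Exchanging the two coordinates in the domain, the curve and the function reduces this to
  the preceding case.\<close>

lemma constant_on_partial_y_zero:
  fixes f :: "real \<times> real \<Rightarrow> real"
  assumes curve: "y_coordinate_curve D I c"
    and diff: "\<And>p. p \<in> D \<Longrightarrow> f differentiable (at p)"
    and zero: "\<And>p. p \<in> D \<Longrightarrow> partial_y f p = 0"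
  shows "(f \<circ> c) constant_on I"
proof -
  have sw: "(prod.swap has_derivative prod.swap) (at p)" for p :: "real \<times> real"
    unfolding prod.swap_def
    by (intro has_derivative_Pair has_derivative_fst has_derivative_snd has_derivative_ident)
  have D: "x_coordinate_curve (prod.swap ` D) I (prod.swap \<circ> c)"
    using curve unfolding x_coordinate_curve_def y_coordinate_curve_def curve_in_def
    by (auto simp: constant_on_def o_def prod.swap_def image_iff intro!: continuous_intros)
  have "(f \<circ> prod.swap) differentiable (at p)" if "p \<in> prod.swap ` D" for p
    using that diff sw unfolding differentiable_def by (metis diff_chain_at imageE swap_swap)
  moreover have "partial_x (f \<circ> prod.swap) p = 0" if "p \<in> prod.swap ` D" for p
    using that zero by (auto simp: partial_x_def partial_y_def)
  ultimately have "((f \<circ> prod.swap) \<circ> (prod.swap \<circ> c)) constant_on I"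
    by (intro constant_on_partial_x_zero[OF D])
  then show ?thesis
    by (simp add: o_def)
qed

section \<open>Comparison of Laurent coefficients for an equivariant frame\<close>

theorem proposition3p3:
  fixes D :: "(real \<times> real) set"
    and \<gamma> :: "real \<times> real \<Rightarrow> real \<times> real"
    and U :: "real \<times> real \<Rightarrow> real \<Rightarrow> complex^2^2"
    and K :: "real \<times> real \<Rightarrow> complex^2^2"
    and chi :: "real \<Rightarrow> complex^2^2"
    and \<phi> :: "real \<times> real \<Rightarrow> real"
    and a b :: "real \<Rightarrow> real"
  assumes "open D"
    and "diffeomorphism_on D D \<gamma>"
    and "\<forall>p\<in>D. U p \<in> twisted_loop_SU2"
    and "\<forall>l. l \<noteq> 0 \<longrightarrow> smooth_on D (\<lambda>p. U p l)"
    and "\<forall>p\<in>D. K p \<in> SU2"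
    and "smooth_on D K"
    and "\<forall>l. l \<noteq> 0 \<longrightarrow> chi l \<in> SU2"
    and "smooth_on D \<phi>"
    and "smooth_on (fst ` D) a" and "\<forall>x\<in>fst ` D. a x > 0"
    and "smooth_on (snd ` D) b" and "\<forall>y\<in>snd ` D. b y > 0"
    and "\<forall>x y l. (x, y) \<in> D \<and> l \<noteq> 0 \<longrightarrow>
           partial_x (\<lambda>p. U p l) (x, y) =
             (\<i> / 2) *\<^sub>C (U (x, y) l **
               mat2 (- of_real (partial_x \<phi> (x, y))) (of_real (a x * l))
                    (of_real (a x * l)) (of_real (partial_x \<phi> (x, y))))"
    and "\<forall>x y l. (x, y) \<in> D \<and> l \<noteq> 0 \<longrightarrow>
           partial_y (\<lambda>p. U p l) (x, y) =
             (- (\<i> * of_real (b y) / (2 * of_real l))) *\<^sub>C (U (x, y) l **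
               mat2 0 (exp (\<i> * of_real (\<phi> (x, y))))
                    (exp (- \<i> * of_real (\<phi> (x, y)))) 0)"
    and "\<forall>p\<in>D. \<forall>l. l \<noteq> 0 \<longrightarrow> U (\<gamma> p) l = chi l ** U p l ** K p"
  shows "(\<forall>I c. x_coordinate_curve D I c \<longrightarrow> x_coordinate_curve D I (\<gamma> \<circ> c)) \<and>
         (\<forall>I c. y_coordinate_curve D I c \<longrightarrow> y_coordinate_curve D I (\<gamma> \<circ> c)) \<and>
         (\<forall>p\<in>D. partial_x (snd \<circ> \<gamma>) p = 0) \<and>
         (\<forall>p\<in>D. partial_y (fst \<circ> \<gamma>) p = 0)"
proof -
  note SU = assms(3) and dU = assms(4) and KSU = assms(5) and dK = assms(6) and chi = assms(7)
    and a = assms(10) and b = assms(12) and Ux = assms(13) and Uy = assms(14) and eq = assms(15)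
  have d\<gamma>: "smooth_on D \<gamma>" and maps: "\<gamma> p \<in> D" if "p \<in> D" for p
    using assms(2) that by (auto simp: diffeomorphism_on_def bij_betw_def)
  \<comment> \<open>These are the coefficients, sorted by powers of \<open>l\<close>, of the
    matrices standing to the right of \<open>U\<close> in the two equations: \<open>P\<close>
    belongs to the constant term, \<open>S\<close> to \<open>l\<close> and \<open>T\<close> to
    \<open>1 / l\<close>. The scalar prefactors are absorbed.\<close>
  define P where "P p = mat2 (- (\<i> / 2) * of_real (partial_x \<phi> p)) 0 0
    ((\<i> / 2) * of_real (partial_x \<phi> p))" for p :: "real \<times> real"
  define S where "S p = mat2 0 (\<i> / 2 * of_real (a (fst p))) (\<i> / 2 * of_real (a (fst p))) 0"
    for p :: "real \<times> real"
  define T where "T p = mat2 0 (- \<i> / 2 * of_real (b (snd p)) * exp (\<i> * of_real (\<phi> p)))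
    (- \<i> / 2 * of_real (b (snd p)) * exp (- \<i> * of_real (\<phi> p))) 0" for p :: "real \<times> real"
  have px: "partial_x (\<lambda>p. U p l) p = U p l ** (P p + l *\<^sub>R S p)" if "p \<in> D" "l \<noteq> 0" for p l
  proof -
    have "partial_x (\<lambda>p. U p l) p = U p l ** ((\<i> / 2) *\<^sub>C mat2 (- of_real (partial_x \<phi> p))
        (of_real (a (fst p) * l)) (of_real (a (fst p) * l)) (of_real (partial_x \<phi> p)))"
      using Ux[rule_format, of "fst p" "snd p" l] that by (simp add: cscale_mult_right)
    then show ?thesis
      unfolding P_def S_def cscale_mat2 scaleR_mat2 mat2_add
      by (simp add: scaleR_conv_of_real mult_ac)
  qed
  have py: "partial_y (\<lambda>p. U p l) p = U p l ** ((1 / l) *\<^sub>R T p)" if "p \<in> D" "l \<noteq> 0" for p l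
  proof -
    have "partial_y (\<lambda>p. U p l) p = U p l ** ((- (\<i> * of_real (b (snd p)) / (2 * of_real l))) *\<^sub>C
        mat2 0 (exp (\<i> * of_real (\<phi> p))) (exp (- \<i> * of_real (\<phi> p))) 0)"
      using Uy[rule_format, of "fst p" "snd p" l] that by (simp add: cscale_mult_right)
    then show ?thesis
      unfolding T_def cscale_mat2 scaleR_mat2 by (simp add: scaleR_conv_of_real mult.commute)
  qed
  \<comment> \<open>The off-diagonal entries are nonzero: \<open>a\<close> and \<open>b\<close> are
    positive and the exponential has no zeros.\<close>
  have Snz: "S p \<noteq> 0" and Tnz: "T p \<noteq> 0" if "p \<in> D" for p
    using a b that by (force simp: S_def T_def mat2_eq_iff simp flip: mat2_zero)+
  \<comment> \<open>On the left the derivative of \<open>U\<close> at \<open>\<gamma> p\<close>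
    carries the factor \<open>U (\<gamma> p) l\<close>, which equals
    \<open>chi l ** U p l ** K p\<close>. Both sides thus begin with the invertible factor
    \<open>chi l ** U p l\<close>; once it is cancelled, \<open>l\<close> survives only in explicit
    powers.\<close>
  have Laurent: "K p ** (fst (\<gamma>' w) *\<^sub>R (P (\<gamma> p) + l *\<^sub>R S (\<gamma> p)) + snd (\<gamma>' w) *\<^sub>R (1 / l) *\<^sub>R T (\<gamma> p))
      = K' w + (fst w *\<^sub>R (P p + l *\<^sub>R S p) + snd w *\<^sub>R (1 / l) *\<^sub>R T p) ** K p"
    if p: "p \<in> D" and l: "l \<noteq> 0" and \<gamma>': "(\<gamma> has_derivative \<gamma>') (at p)"
      and K': "(K has_derivative K') (at p)" for p l \<gamma>' K' w
  proof -
    let ?F = "\<lambda>q. U q l"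
    let ?X = "chi l ** U p l"
    have dF: "(?F has_derivative (\<lambda>w. U q l ** (fst w *\<^sub>R (P q + l *\<^sub>R S q) +
        snd w *\<^sub>R (1 / l) *\<^sub>R T q))) (at q)" if "q \<in> D" for q
    proof -
      have F': "(?F has_derivative frechet_derivative ?F (at q)) (at q)"
        using dU l that smooth_on_imp_has_derivative by blast
      moreover have "frechet_derivative ?F (at q) w = U q l ** (fst w *\<^sub>R (P q + l *\<^sub>R S q) +
        snd w *\<^sub>R (1 / l) *\<^sub>R T q)" for w
        using has_derivative_eq_partials[OF F', of w] px[OF that l] py[OF that l]
        by (simp add: matrix_mult.add_right matrix_mult.scaleR_right)
      ultimately show ?thesis
        by (metis (no_types, lifting) ext)
    qed
    have "invertible (chi l)" and "invertible (U p l)"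
      using chi SU p l by (auto simp: twisted_loop_SU2_def intro: SU2_invertible)
    then have inv: "invertible ?X"
      by (rule invertible_mult)
    have eq': "\<forall>q\<in>D. U (\<gamma> q) l = chi l ** U q l ** K q"
      using eq l by simp
    note derivative_equivariance[where F = ?F and g = \<gamma> and K = K and X = "chi l",
        OF \<open>open D\<close> p \<gamma>' dF[OF p] dF[OF maps[OF p]] K' eq', of w]
    then have "?X ** (K p ** (fst (\<gamma>' w) *\<^sub>R (P (\<gamma> p) + l *\<^sub>R S (\<gamma> p)) +
        snd (\<gamma>' w) *\<^sub>R (1 / l) *\<^sub>R T (\<gamma> p))) =
      ?X ** (K' w + (fst w *\<^sub>R (P p + l *\<^sub>R S p) + snd w *\<^sub>R (1 / l) *\<^sub>R T p) ** K p)"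
      unfolding eq'[rule_format, OF p]
      by (simp only: matrix_mul_assoc matrix_mult.add_right[of ?X])
    then show ?thesis
      by (rule invertible_mult_left_cancel[OF inv])
  qed
  have split: "(snd w = 0 \<longrightarrow> snd (\<gamma>' w) = 0) \<and> (fst w = 0 \<longrightarrow> fst (\<gamma>' w) = 0)"
    if p: "p \<in> D" and \<gamma>': "(\<gamma> has_derivative \<gamma>') (at p)" for p \<gamma>' w
  proof -
    obtain K' where K': "(K has_derivative K') (at p)"
      using dK p smooth_on_imp_has_derivative by blast
    \<comment> \<open>The coefficients of the difference of the two sides in \<open>Laurent\<close>.
      The derivative of \<open>K\<close> enters only the constant term \<open>?A\<close>, so the
      vanishing of \<open>?B\<close> and \<open>?C\<close> links \<open>\<gamma>' w\<close> to
      \<open>w\<close> without it.\<close>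
    let ?A = "fst (\<gamma>' w) *\<^sub>R (K p ** P (\<gamma> p)) - K' w - fst w *\<^sub>R (P p ** K p)"
    let ?B = "fst (\<gamma>' w) *\<^sub>R (K p ** S (\<gamma> p)) - fst w *\<^sub>R (S p ** K p)"
    let ?C = "snd (\<gamma>' w) *\<^sub>R (K p ** T (\<gamma> p)) - snd w *\<^sub>R (T p ** K p)"
    have "?A + l *\<^sub>R ?B + (1 / l) *\<^sub>R ?C = 0" if "l \<noteq> 0" for l
      using Laurent[OF p that \<gamma>' K', of w]
      by (simp add: matrix_mult.add_left matrix_mult.add_right matrix_mult.scaleR_left
          matrix_mult.scaleR_right algebra_simps)
    then have "\<forall>l. l \<noteq> 0 \<longrightarrow> ?A + l *\<^sub>R ?B + (1 / l) *\<^sub>R ?C = 0"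
      by blast
    note BC = Laurent_coeffs_zero(2,3)[OF this]
    have "X = 0" if "K p ** X = 0" for X :: "complex^2^2"
      using invertible_mult_left_cancel[of "K p" X 0] SU2_invertible KSU p that
      by (simp add: matrix_mult.zero_right)
    then have "K p ** S (\<gamma> p) \<noteq> 0" and "K p ** T (\<gamma> p) \<noteq> 0"
      using Snz[OF maps[OF p]] Tnz[OF maps[OF p]] by blast+
    \<comment> \<open>If \<open>snd w = 0\<close>, the second equation makes a scalar multiple of
      the nonzero matrix \<open>K p ** T (\<gamma> p)\<close> vanish, which forces
      \<open>snd (\<gamma>' w) = 0\<close>. The first equation does the same for
      \<open>fst\<close>.\<close>
    moreover have "fst (\<gamma>' w) *\<^sub>R (K p ** S (\<gamma> p)) = fst w *\<^sub>R (S p ** K p)"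
      and "snd (\<gamma>' w) *\<^sub>R (K p ** T (\<gamma> p)) = snd w *\<^sub>R (T p ** K p)"
      using BC by (simp_all only: right_minus_eq)
    ultimately show ?thesis
      by (metis scaleR_eq_0_iff)
  qed
  have diff: "\<gamma> differentiable (at p)" if "p \<in> D" for p
    using d\<gamma>[OF that] that by (rule smooth_on_imp_differentiable)
  have fst_diff: "(fst \<circ> \<gamma>) differentiable (at p)" and snd_diff: "(snd \<circ> \<gamma>) differentiable (at p)"
    if "p \<in> D" for p
    using diff[OF that] unfolding differentiable_def o_def
    by (blast intro: has_derivative_fst has_derivative_snd)+
  have x0: "partial_x (snd \<circ> \<gamma>) p = 0" and y0: "partial_y (fst \<circ> \<gamma>) p = 0" if p: "p \<in> D" for p
  proof -
    obtain \<gamma>' where \<gamma>': "(\<gamma> has_derivative \<gamma>') (at p)"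
      using diff[OF p] by (auto simp: differentiable_def)
    then have "((snd \<circ> \<gamma>) has_derivative (\<lambda>w. snd (\<gamma>' w))) (at p)"
      and "((fst \<circ> \<gamma>) has_derivative (\<lambda>w. fst (\<gamma>' w))) (at p)"
      by (simp_all add: o_def has_derivative_fst has_derivative_snd)
    then have "partial_x (snd \<circ> \<gamma>) p = snd (\<gamma>' (1, 0))"
      and "partial_y (fst \<circ> \<gamma>) p = fst (\<gamma>' (0, 1))"
      by (simp_all add: partial_x_eq partial_y_eq)
    with split[OF p \<gamma>', of "(1, 0)"] split[OF p \<gamma>', of "(0, 1)"]
    show "partial_x (snd \<circ> \<gamma>) p = 0" and "partial_y (fst \<circ> \<gamma>) p = 0"
      by simp_all
  qed
  have curve: "curve_in D I (\<gamma> \<circ> c)" if c: "curve_in D I c" for I c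
  proof -
    have "continuous_on D \<gamma>"
      using diff by (simp add: continuous_at_imp_continuous_on differentiable_imp_continuous_within)
    then have "continuous_on I (\<gamma> \<circ> c)"
      using c continuous_on_compose continuous_on_subset unfolding curve_in_def by blast
    moreover have "(\<gamma> \<circ> c) ` I \<subseteq> D"
      using c maps unfolding curve_in_def image_comp[symmetric] by blast
    ultimately show ?thesis
      using c unfolding curve_in_def by blast
  qed
  \<comment> \<open>Vanishing partial derivatives give constancy only on connected pieces of a
    horizontal or vertical slice of \<open>D\<close>; a continuous coordinate curve stays within one
    such piece.\<close>
  have "x_coordinate_curve D I (\<gamma> \<circ> c)" if c: "x_coordinate_curve D I c" for I c
    using constant_on_partial_x_zero[OF c snd_diff x0] curve c
    by (simp add: x_coordinate_curve_def o_assoc)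
  moreover have "y_coordinate_curve D I (\<gamma> \<circ> c)" if c: "y_coordinate_curve D I c" for I c
    using constant_on_partial_y_zero[OF c fst_diff y0] curve c
    by (simp add: y_coordinate_curve_def o_assoc)
  ultimately show ?thesis
    using x0 y0 by blast
qed

end
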